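(* Let $n\ge 1$ and let $\Omega\subset\mathbb{R}^n$ be a bounded open set with $C^{1,\gamma}$-boundary (for some $\gamma\in(0,1)$). Then $\mu$ is additive on bounded, separated sets in $\mathcal{E}$: if $E,F\in\mathcal{E}$ are bounded and disjoint and $\mathrm{dist}(E,F)\ge c$ for some $c>0$, then $E\cup F\in\mathcal{E}$ and $$\mu(E\cup F)=\mu(E)+\mu(F).$$
   Context: For $s\in(0,1)$ and measurable $A,B\subseteq\mathbb{R}^n$, set $L(A,B):=\int_A\int_B\frac{1}{|x-y|^{n+s}}\,dx\,dy\in[0,+\infty]$ (with $L(A,B)=0$ if $A$ or $B$ is empty). Write $\mathcal{C}E=\mathbb{R}^n\setminus E$. The $s$-perimeter of a measurable set $E\subseteq\mathbb{R}^n$ in $\Omega$ is $$\mathrm{Per}_s(E;\Omega):=L(E\cap\Omega,(\mathcal{C}E)\cap\Omega)+L(E\cap\Omega,(\mathcal{C}E)\cap(\mathcal{C}\Omega))+L(E\cap(\mathcal{C}\Omega),(\mathcal{C}E)\cap\Omega).$$ $\mathcal{E}$ denotes the family of measurable sets $E\subseteq\mathbb{R}^n$ for which the limit $\mu(E):=\lim_{s\searrow0}s\,\mathrm{Per}_s(E;\Omega)$ exists (as a finite number). $\mathrm{dist}(E,F)=\inf\{|x-y|:x\in E,\,y\in F\}$. *)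

theory Defs
  imports "HOL-Analysis.Analysis"
begin

(* For x = y the integrand has the junk value 0 instead of infinity; for each fixed y this
   concerns a single point x, which is a null set. *)
definition interaction :: "real \<Rightarrow> 'a::euclidean_space set \<Rightarrow> 'a set \<Rightarrow> ennreal" where
  "interaction s A B =
     (\<integral>\<^sup>+ y\<in>A. (\<integral>\<^sup>+ x\<in>B. ennreal (1 / norm (x - y) powr (real DIM('a) + s)) \<partial>lebesgue) \<partial>lebesgue)"

definition s_perimeter :: "real \<Rightarrow> 'a::euclidean_space set \<Rightarrow> 'a set \<Rightarrow> ennreal" where
  "s_perimeter s E \<Omega> =
     interaction s (E \<inter> \<Omega>) ((- E) \<inter> \<Omega>)
   + interaction s (E \<inter> \<Omega>) ((- E) \<inter> (- \<Omega>))
   + interaction s (E \<inter> (- \<Omega>)) ((- E) \<inter> \<Omega>)"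

definition limit_family :: "'a::euclidean_space set \<Rightarrow> 'a set set" where
  "limit_family \<Omega> =
     {E \<in> sets lebesgue.
        \<exists>l<\<infinity>. ((\<lambda>s. ennreal s * s_perimeter s E \<Omega>) \<longlongrightarrow> l) (at_right 0)}"

(* Meaningful only for E in limit_family \<Omega>. *)
definition limit_mu :: "'a::euclidean_space set \<Rightarrow> 'a set \<Rightarrow> real" where
  "limit_mu \<Omega> E = enn2real (Lim (at_right 0) (\<lambda>s. ennreal s * s_perimeter s E \<Omega>))"

(* Unlike setdist, which is 0 if one of the sets is empty, this follows the convention that
   the infimum of the empty set is infinity. *)
definition set_distance :: "'a::metric_space set \<Rightarrow> 'a set \<Rightarrow> ereal" where
  "set_distance E F = Inf {ereal (dist x y) | x y. x \<in> E \<and> y \<in> F}"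

definition C1_holder :: "real \<Rightarrow> ('a::euclidean_space \<Rightarrow> real) \<Rightarrow> bool" where
  "C1_holder \<gamma> \<phi> \<longleftrightarrow>
     (\<exists>G C. (\<forall>x. GDERIV \<phi> x :> G x) \<and>
            (\<forall>x y. norm (G x - G y) \<le> C * norm (x - y) powr \<gamma>))"

(* Near each boundary point the set is, in suitable orthonormal coordinates, the strict
   epigraph of a C^{1,gamma} function of n - 1 variables. The last coordinate is the
   direction \<nu>, and the n - 1 variables are the projection of x to the hyperplane orthogonal
   to \<nu>. Only the values of \<phi> on that hyperplane matter, and every C^{1,gamma} function on the
   hyperplane extends to the whole space, constantly along \<nu>. Asking \<phi> to be globally defined
   with globally Hoelder gradient is no restriction: multiply by a cutoff and shrink r. *)
definition C1_holder_boundary :: "real \<Rightarrow> 'a::euclidean_space set \<Rightarrow> bool" where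
  "C1_holder_boundary \<gamma> \<Omega> \<longleftrightarrow>
     (\<forall>p\<in>frontier \<Omega>. \<exists>r \<nu> \<phi>. 0 < r \<and> norm \<nu> = 1 \<and> C1_holder \<gamma> \<phi> \<and>
        \<Omega> \<inter> ball p r = {x \<in> ball p r. \<phi> (x - (x \<bullet> \<nu>) *\<^sub>R \<nu>) < x \<bullet> \<nu>})"

end

theory Submission
  imports Defs
begin

text \<open>Splitting the three interactions that make up the perimeters of \<open>E\<close> and \<open>F\<close> shows that
  their sum exceeds the perimeter of \<open>E \<union> F\<close> only by interactions between parts of \<open>E\<close> and
  parts of \<open>F\<close>. The kernel is at most \<open>c\<close> to the power \<open>-(n + s)\<close> there, so these interactions
  stay bounded as \<open>s\<close> tends to \<open>0\<close>, and the factor \<open>s\<close> removes them in the limit.\<close>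

text \<open>Sigma-finiteness is what measurability of a parameter-dependent integral requires. A
  countable cover of finite \<open>lborel\<close> measure also serves the completion, which has the
  same values on these sets.\<close>

lemma sigma_finite_lebesgue: "sigma_finite_measure (lebesgue :: 'a::euclidean_space measure)"
proof (rule sigma_finite_measure.intro)
  obtain S :: "'a set set" where S: "countable S" "S \<subseteq> sets lborel" "\<Union>S = space lborel"
      "\<forall>a\<in>S. emeasure lborel a \<noteq> \<infinity>"
    using lborel.sigma_finite_countable by blast
  then have "S \<subseteq> sets lebesgue"
    by (auto intro: sets_completionI_sets)
  then show "\<exists>A::'a set set. countable A \<and> A \<subseteq> sets lebesgue \<and> \<Union>A = space lebesgue \<and>
      (\<forall>a\<in>A. emeasure lebesgue a \<noteq> \<infinity>)"
    using S by (intro exI[of _ S]) (auto simp: subset_eq)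
qed

lemma measurable_interaction_kernel:
  "(\<lambda>x. ennreal (1 / norm (x - y) powr p)) \<in> borel_measurable (lebesgue :: 'a::euclidean_space measure)"
  by (rule measurable_completion) measurable

text \<open>Needed to add outer integrals: the inner integral must be measurable in the remaining
  variable. This follows from joint measurability of the integrand.\<close>

lemma measurable_interaction_potential:
  fixes B :: "'a::euclidean_space set"
  assumes "B \<in> sets lebesgue"
  shows "(\<lambda>y. \<integral>\<^sup>+ x\<in>B. ennreal (1 / norm (x - y) powr p) \<partial>lebesgue) \<in> borel_measurable lebesgue"
proof -
  interpret sigma_finite_measure "lebesgue :: 'a measure"
    by (rule sigma_finite_lebesgue)
  \<comment> \<open>The kernel is Borel, so it suffices that both coordinates are measurable into
    \<open>borel\<close>; only the indicator of \<open>B\<close> uses a Lebesgue measurable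
    set.\<close>
  have id: "(\<lambda>x::'a. x) \<in> lebesgue \<rightarrow>\<^sub>M borel"
    by (rule measurable_completion) simp
  have [measurable]: "fst \<in> lebesgue \<Otimes>\<^sub>M lebesgue \<rightarrow>\<^sub>M (borel :: 'a measure)"
      "snd \<in> lebesgue \<Otimes>\<^sub>M lebesgue \<rightarrow>\<^sub>M (borel :: 'a measure)"
    using measurable_compose[OF measurable_fst id] measurable_compose[OF measurable_snd id]
    by auto
  note assms[measurable]
  have "(\<lambda>z::'a \<times> 'a. ennreal (1 / norm (snd z - fst z) powr p) * indicator B (snd z))
      \<in> borel_measurable (lebesgue \<Otimes>\<^sub>M lebesgue)"
    by measurable
  then show ?thesis
    by (intro borel_measurable_nn_integral) (simp add: case_prod_beta')
qed

lemma interaction_Un_left: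
  fixes A A' B :: "'a::euclidean_space set"
  assumes "A \<in> sets lebesgue" "A' \<in> sets lebesgue" "B \<in> sets lebesgue" "A \<inter> A' = {}"
  shows "interaction s (A \<union> A') B = interaction s A B + interaction s A' B"
  unfolding interaction_def
  by (intro nn_integral_disjoint_pair measurable_interaction_potential assms)

lemma interaction_Un_right:
  fixes A B B' :: "'a::euclidean_space set"
  assumes A: "A \<in> sets lebesgue" and B: "B \<in> sets lebesgue" "B' \<in> sets lebesgue" "B \<inter> B' = {}"
  shows "interaction s A (B \<union> B') = interaction s A B + interaction s A B'"
proof -
  have "interaction s A (B \<union> B') =
      (\<integral>\<^sup>+ y. (\<integral>\<^sup>+ x\<in>B. ennreal (1 / norm (x - y) powr (real DIM('a) + s)) \<partial>lebesgue) * indicator A y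
        + (\<integral>\<^sup>+ x\<in>B'. ennreal (1 / norm (x - y) powr (real DIM('a) + s)) \<partial>lebesgue) * indicator A y
        \<partial>lebesgue)"
    unfolding interaction_def
    using nn_integral_disjoint_pair[OF measurable_interaction_kernel B]
    by (simp add: distrib_right)
  also have "\<dots> = interaction s A B + interaction s A B'"
    unfolding interaction_def using assms
    by (intro nn_integral_add borel_measurable_times_ennreal measurable_interaction_potential
        borel_measurable_indicator)
  finally show ?thesis .
qed

lemma interaction_le_separated:
  fixes A B :: "'a::euclidean_space set"
  assumes A: "A \<in> sets lebesgue" and B: "B \<in> sets lebesgue" and c: "0 < c" and s: "0 < s"
    and sep: "\<And>x y. x \<in> A \<Longrightarrow> y \<in> B \<Longrightarrow> c \<le> dist x y"
  shows "interaction s A B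
    \<le> ennreal (1 / c powr (real DIM('a) + s)) * emeasure lebesgue A * emeasure lebesgue B"
proof -
  let ?K = "ennreal (1 / c powr (real DIM('a) + s))"
  have "1 / norm (x - y) powr (real DIM('a) + s) \<le> 1 / c powr (real DIM('a) + s)"
    if "y \<in> A" "x \<in> B" for x y
  proof -
    have "c \<le> norm (x - y)"
      using sep[OF that] by (simp add: dist_norm norm_minus_commute)
    with c s show ?thesis
      by (intro frac_le powr_mono2) auto
  qed
  then have "interaction s A B \<le> (\<integral>\<^sup>+ y\<in>A. (\<integral>\<^sup>+ x\<in>B. ?K \<partial>lebesgue) \<partial>lebesgue)"
    unfolding interaction_def
    by (intro nn_integral_mono)
      (auto split: split_indicator intro!: nn_integral_mono ennreal_leI)
  also have "\<dots> = ?K * emeasure lebesgue A * emeasure lebesgue B"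
    by (simp only: nn_integral_cmult_indicator A B) (simp only: mult_ac)
  finally show ?thesis .
qed

text \<open>This is the formula for the perimeter of \<open>E\<close> with the complement of
  \<open>E\<close> replaced by \<open>F\<close>: for disjoint sets, the share of that perimeter due
  to \<open>F\<close>.\<close>

definition cross_interaction :: "real \<Rightarrow> 'a::euclidean_space set \<Rightarrow> 'a set \<Rightarrow> 'a set \<Rightarrow> ennreal" where
  "cross_interaction s E F \<Omega> =
     interaction s (E \<inter> \<Omega>) (F \<inter> \<Omega>)
   + interaction s (E \<inter> \<Omega>) (F \<inter> (- \<Omega>))
   + interaction s (E \<inter> (- \<Omega>)) (F \<inter> \<Omega>)"

text \<open>By disjointness, the complement of \<open>E\<close> consists of \<open>F\<close> and the
  complement of \<open>E \<union> F\<close>; each of the three interactions splits accordingly in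
  its second argument.\<close>

lemma s_perimeter_split:
  fixes E F \<Omega> :: "'a::euclidean_space set"
  assumes [measurable]: "E \<in> sets lebesgue" "F \<in> sets lebesgue" "\<Omega> \<in> sets lebesgue"
    and disj: "E \<inter> F = {}"
  shows "s_perimeter s E \<Omega> =
      interaction s (E \<inter> \<Omega>) ((- (E \<union> F)) \<inter> \<Omega>)
    + interaction s (E \<inter> \<Omega>) ((- (E \<union> F)) \<inter> (- \<Omega>))
    + interaction s (E \<inter> (- \<Omega>)) ((- (E \<union> F)) \<inter> \<Omega>)
    + cross_interaction s E F \<Omega>"
proof -
  have split: "interaction s A ((- E) \<inter> C) =
      interaction s A ((- (E \<union> F)) \<inter> C) + interaction s A (F \<inter> C)"
    if "A \<in> sets lebesgue" "C \<in> sets lebesgue" for A C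
  proof -
    have "(- E) \<inter> C = ((- (E \<union> F)) \<inter> C) \<union> (F \<inter> C)"
      using disj by auto
    then show ?thesis
      using interaction_Un_right[of A "(- (E \<union> F)) \<inter> C" "F \<inter> C" s] that assms
      by (auto simp: Compl_in_sets_lebesgue simp del: Compl_Un)
  qed
  show ?thesis
    unfolding s_perimeter_def cross_interaction_def
    using assms by (simp add: split Compl_in_sets_lebesgue add_ac del: Compl_Un)
qed

text \<open>After splitting both perimeters, the terms against the complement of
  \<open>E \<union> F\<close> recombine by additivity in the first argument. The identity avoids
  subtraction, since every term may be infinite.\<close>

lemma s_perimeter_Un:
  fixes E F \<Omega> :: "'a::euclidean_space set"
  assumes "E \<in> sets lebesgue" "F \<in> sets lebesgue" "\<Omega> \<in> sets lebesgue" and disj: "E \<inter> F = {}"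
  shows "s_perimeter s E \<Omega> + s_perimeter s F \<Omega> =
    s_perimeter s (E \<union> F) \<Omega> + (cross_interaction s E F \<Omega> + cross_interaction s F E \<Omega>)"
proof -
  have join: "interaction s ((E \<union> F) \<inter> C) B = interaction s (E \<inter> C) B + interaction s (F \<inter> C) B"
    if "C \<in> sets lebesgue" "B \<in> sets lebesgue" for B C
    using interaction_Un_left[of "E \<inter> C" "F \<inter> C" B s] that assms
    by (auto simp: Int_Un_distrib2)
  have disj': "F \<inter> E = {}"
    using disj by auto
  show ?thesis
    unfolding s_perimeter_split[OF assms] s_perimeter_split[OF assms(2,1,3) disj'] Un_commute[of F E]
    unfolding s_perimeter_def
    using assms by (simp add: join Compl_in_sets_lebesgue add_ac del: Compl_Un)
qed

lemma cross_interaction_le_separated: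
  fixes E F \<Omega> :: "'a::euclidean_space set"
  assumes "E \<in> sets lebesgue" "F \<in> sets lebesgue" "\<Omega> \<in> sets lebesgue" "0 < c" "0 < s"
    and "\<And>x y. x \<in> E \<Longrightarrow> y \<in> F \<Longrightarrow> c \<le> dist x y"
  shows "cross_interaction s E F \<Omega>
    \<le> 3 * (ennreal (1 / c powr (real DIM('a) + s)) * emeasure lebesgue E * emeasure lebesgue F)"
proof -
  have "interaction s (E \<inter> X) (F \<inter> Y)
      \<le> ennreal (1 / c powr (real DIM('a) + s)) * emeasure lebesgue E * emeasure lebesgue F"
    (is "_ \<le> ?b") if "X \<in> sets lebesgue" "Y \<in> sets lebesgue" for X Y
    using that assms
    by (intro order.trans[OF interaction_le_separated[of _ _ c]] mult_mono emeasure_mono) auto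
  \<comment> \<open>One copy of the bound for each of the three interactions.\<close>
  then have "cross_interaction s E F \<Omega> \<le> ?b + ?b + ?b"
    unfolding cross_interaction_def using assms(3)
    by (intro add_mono) (auto simp: Compl_in_sets_lebesgue)
  also have "\<dots> = (1 + 1 + 1) * ?b"
    by (simp only: distrib_right mult_1)
  also have "(1 + 1 + 1 :: ennreal) = 3"
    by simp
  finally show ?thesis .
qed

lemma cross_interaction_vanishes:
  fixes E F \<Omega> :: "'a::euclidean_space set"
  assumes "E \<in> sets lebesgue" "F \<in> sets lebesgue" "\<Omega> \<in> sets lebesgue" "bounded E" "bounded F"
    and c: "0 < c" "\<And>x y. x \<in> E \<Longrightarrow> y \<in> F \<Longrightarrow> c \<le> dist x y"
  shows "((\<lambda>s. ennreal s * cross_interaction s E F \<Omega>) \<longlongrightarrow> 0) (at_right 0)"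
proof -
  \<comment> \<open>Boundedness makes both measures finite, so the bound can be written as a real
    number and its limit taken in the reals.\<close>
  define e f where "e = measure lebesgue E" and "f = measure lebesgue F"
  have ef: "emeasure lebesgue E = ennreal e" "emeasure lebesgue F = ennreal f" "0 \<le> e" "0 \<le> f"
    unfolding e_def f_def
    by (rule emeasure_eq_measure2 measure_nonneg bounded_set_imp_lmeasurable assms)+
  have bound: "ennreal s * cross_interaction s E F \<Omega>
      \<le> ennreal (s * (3 * (1 / c powr (real DIM('a) + s) * e * f)))" if "0 < s" for s
  proof -
    have prod: "ennreal s * (3 * (ennreal k * ennreal e * ennreal f)) = ennreal (s * (3 * (k * e * f)))"
      if "0 \<le> k" for k
      using \<open>0 < s\<close> \<open>0 \<le> k\<close> ef(3,4) by (simp add: ennreal_mult)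
    have "ennreal s * cross_interaction s E F \<Omega>
        \<le> ennreal s * (3 * (ennreal (1 / c powr (real DIM('a) + s)) * ennreal e * ennreal f))"
      unfolding ef(1,2)[symmetric]
      by (intro mult_left_mono cross_interaction_le_separated assms that) auto
    also have "\<dots> = ennreal (s * (3 * (1 / c powr (real DIM('a) + s) * e * f)))"
      by (rule prod) simp
    finally show ?thesis .
  qed
  \<comment> \<open>As c > 0, the kernel bound is continuous in s and tends to a finite value, so
    the factor s forces the limit 0.\<close>
  have "((\<lambda>s. s * (3 * (1 / c powr (real DIM('a) + s) * e * f))) \<longlongrightarrow>
      0 * (3 * (1 / c powr (real DIM('a) + 0) * e * f))) (at_right 0)"
    using c(1) by (intro tendsto_intros) auto
  then have upper: "((\<lambda>s. ennreal (s * (3 * (1 / c powr (real DIM('a) + s) * e * f)))) \<longlongrightarrow> 0) (at_right 0)"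
    using tendsto_ennrealI by fastforce
  have "\<forall>\<^sub>F s in at_right 0. ennreal s * cross_interaction s E F \<Omega>
      \<le> ennreal (s * (3 * (1 / c powr (real DIM('a) + s) * e * f)))"
    by (rule eventually_mono[OF eventually_at_right_less bound])
  from tendsto_sandwich[OF _ this tendsto_const upper] show ?thesis
    by simp
qed

text \<open>Limits along the nontrivial filter \<open>at_right 0\<close> are unique, so
  \<open>Lim\<close> in \<open>limit_mu\<close> returns the limit that membership provides.\<close>

lemma limit_family_tendsto:
  assumes "E \<in> limit_family \<Omega>"
  obtains l where "l < \<infinity>" "((\<lambda>s. ennreal s * s_perimeter s E \<Omega>) \<longlongrightarrow> l) (at_right 0)"
    "limit_mu \<Omega> E = enn2real l"
  using assms unfolding limit_family_def limit_mu_def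
  by (auto simp: tendsto_Lim)

theorem proposition2p4:
  fixes \<Omega> E F :: "'a::euclidean_space set" and \<gamma> c :: real
  assumes "bounded \<Omega>" and "open \<Omega>"
    and "0 < \<gamma>" and "\<gamma> < 1" and "C1_holder_boundary \<gamma> \<Omega>"
    and "E \<in> limit_family \<Omega>" and "F \<in> limit_family \<Omega>"
    and "bounded E" and "bounded F" and "E \<inter> F = {}"
    and "0 < c" and "ereal c \<le> set_distance E F"
  shows "E \<union> F \<in> limit_family \<Omega> \<and> limit_mu \<Omega> (E \<union> F) = limit_mu \<Omega> E + limit_mu \<Omega> F"
proof -
  have meas: "E \<in> sets lebesgue" "F \<in> sets lebesgue" "\<Omega> \<in> sets lebesgue"
    using assms(2,6,7) by (auto simp: limit_family_def)
  \<comment> \<open>The infimum is a lower bound for each pair; if a set is empty, the claim is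
    vacuous.\<close>
  have sep: "c \<le> dist x y" if "x \<in> E" "y \<in> F" for x y
  proof -
    have "set_distance E F \<le> ereal (dist x y)"
      unfolding set_distance_def using that by (intro Inf_lower) auto
    with assms(12) show ?thesis
      using order.trans by fastforce
  qed
  have sep': "c \<le> dist x y" if "x \<in> F" "y \<in> E" for x y
    using sep[OF that(2,1)] by (simp add: dist_commute)
  let ?P = "\<lambda>E s. ennreal s * s_perimeter s E \<Omega>"
  let ?R = "\<lambda>s. ennreal s * cross_interaction s E F \<Omega> + ennreal s * cross_interaction s F E \<Omega>"
  have R: "(?R \<longlongrightarrow> 0) (at_right 0)"
    using tendsto_add[OF cross_interaction_vanishes[OF meas assms(8,9,11) sep]
        cross_interaction_vanishes[OF meas(2,1,3) assms(9,8,11) sep']] by simp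
  obtain l where l: "l < \<infinity>" "(?P E \<longlongrightarrow> l) (at_right 0)" "limit_mu \<Omega> E = enn2real l"
    using limit_family_tendsto[OF assms(6)] .
  obtain m where m: "m < \<infinity>" "(?P F \<longlongrightarrow> m) (at_right 0)" "limit_mu \<Omega> F = enn2real m"
    using limit_family_tendsto[OF assms(7)] .
  have sum: "?P E s + ?P F s = ?P (E \<union> F) s + ?R s" for s
    using s_perimeter_Un[OF meas assms(10), of s] by (simp flip: distrib_left)
  \<comment> \<open>The union's term is recovered by subtracting the remainder. Truncated
    subtraction passes to the limit here because l + m is finite.\<close>
  have "((\<lambda>s. (?P E s + ?P F s) - ?R s) \<longlongrightarrow> (l + m) - 0) (at_right 0)"
    using l(1) m(1) by (intro tendsto_diff_ennreal tendsto_add l m R) auto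
  moreover have "eventually (\<lambda>s. (?P E s + ?P F s) - ?R s = ?P (E \<union> F) s) (at_right 0)"
    \<comment> \<open>Cancelling \<open>?R s\<close> requires it to be finite; since it tends to 0,
      it is eventually below 1.\<close>
    using order_tendstoD(2)[OF R zero_less_one]
  proof eventually_elim
    case (elim s)
    then have "?R s \<noteq> top"
      by (metis ennreal_one_less_top order.strict_trans order.strict_iff_not top_greatest)
    then show ?case
      unfolding sum by (rule ennreal_add_diff_cancel_right)
  qed
  ultimately have lim: "(?P (E \<union> F) \<longlongrightarrow> l + m) (at_right 0)"
    by (simp add: tendsto_cong)
  have fin: "l + m < \<infinity>"
    using l(1) m(1) by simp
  have "E \<union> F \<in> limit_family \<Omega>"
    unfolding limit_family_def using meas lim fin by blast
  moreover have "limit_mu \<Omega> (E \<union> F) = enn2real (l + m)"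
    unfolding limit_mu_def using lim by (simp add: tendsto_Lim)
  ultimately show ?thesis
    \<comment> \<open>\<open>enn2real\<close> sends infinity to 0, so its additivity relies on l and
      m being finite.\<close>
    using l m by (simp add: enn2real_plus)
qed

end
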